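(* Let $m\ge (n+1)(d-r+1)$ and $\lambda_0\in(0,n)$. Suppose the loss $\ell$ satisfies the Loss Assumption and the dataset $\mathcal D$ satisfies the Dataset Assumption (with parameters $E,\gamma$) stated in the context. Then there exists a set $\mathcal{C}\subset\mathbb{R}^m$ of Lebesgue measure zero such that for every $\bm\lambda=(\lambda_1,\dots,\lambda_m)\in(\lambda_0/2,\lambda_0)^m\setminus\mathcal{C}$ both of the following hold: (1) the empirical loss $\bm\theta\mapsto L_n(\bm\theta;\bm\lambda)$ is coercive, i.e. $L_n(\bm\theta;\bm\lambda)\to\infty$ as $\|\bm\theta\|_2\to\infty$; (2) every local minimum $\bm\theta^*$ of $\bm\theta\mapsto L_n(\bm\theta;\bm\lambda)$ has training error at most $\frac{\lambda_0+2E}{\ell'(0)\gamma n}$, i.e. $R_n(\bm\theta^*;f)\le \frac{\lambda_0+2E}{\ell'(0)\gamma n}$.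
   Context: Network. Fix integers $d,n,m\ge 1$ and $1\le r\le d$. For $k\in\{1,\dots,d-r+1\}$ let $\phi_k\in\{0,1\}^d$ be the vector with $\phi_k(j)=1$ if $k\le j\le k+r-1$ and $\phi_k(j)=0$ otherwise, and extend periodically by $\phi_{k+(d-r+1)}=\phi_k$ for all $k\ge1$ (for $r=d$ all $\phi_k$ are the all-ones vector, i.e. the fully connected case). Let $\odot$ be the coordinatewise product and $(z)_+=\max\{z,0\}$. For $\bm\theta=(a_1,\dots,a_m,\bm w_1,\dots,\bm w_m)$ with $a_j\in\mathbb R$, $\bm w_j\in\mathbb R^d$, put $f(x;\bm\theta)=\sum_{j=1}^m a_j(\bm w_j^\top(x\odot\phi_j))_+$. Loss and error. $\mathcal D=\{(x_i,y_i)\}_{i=1}^n$ with $x_i\in\mathbb R^d$, $y_i\in\{-1,1\}$. For $\bm\lambda\in(0,\infty)^m$, $$L_n(\bm\theta;\bm\lambda)=\sum_{i=1}^n\ell(-y_if(x_i;\bm\theta))+\frac12\sum_{j=1}^m\lambda_j\left[a_j^2+\|\bm w_j\|_2^2\right].$$ The training error is $R_n(\bm\theta;f)=\frac1n\sum_{i=1}^n\mathbb I\{y_i\ne\mathrm{sgn}(f(x_i;\bm\theta))\}$. Loss Assumption. $\ell:\mathbb R\to\mathbb R$ is convex, non-decreasing and twice differentiable; $\ell$ and $\ell'$ are both $1$-Lipschitz; there is $a>0$ with $\ell'(z)\le e^{az}$ for all $z\in\mathbb R$; and $\ell'(0)>0$. Dataset Assumption. $\|x_i\|_2\le1$ for all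 $i$, and there exist $E\in[0,n]$, $\gamma\in(0,1]$ and $h\in\mathcal H_{\bm\phi}$ with $\sum_{i=1}^n\mathbb I\{y_ih(x_i)\ge\gamma\}\ge n-E$, where $$\mathcal H_{\bm\phi}=\bigcup_{M\ge1}\Big\{x\mapsto\sum_{j=1}^M c_j(\bm v_j^\top(x\odot\phi_j))_+ : \sum_{j=1}^M|c_j|=1,\ \|\bm v_j\|_2=1\ \text{for all } j\Big\}.$$ *)

theory Defs
  imports "HOL-Analysis.Analysis"
begin

text \<open>
  R^d and R^m are \<open>real ^ 'd\<close> and \<open>real ^ 'm\<close>; the index types are linearly ordered so that
  coordinates and neurons can be numbered: \<open>pos i\<close> is the 1-based position of \<open>i\<close>.
\<close>

definition pos :: "'a::{finite,linorder} \<Rightarrow> nat" where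
  "pos i = card {..i}"

lemma bij_betw_pos: "bij_betw (pos :: 'a::{finite,linorder} \<Rightarrow> nat) UNIV {1..CARD('a)}"
proof -
  have less: "pos i < pos j" if "i < j" for i j :: 'a
    unfolding pos_def using that by (intro psubset_card_mono) auto
  have inj: "inj (pos :: 'a \<Rightarrow> nat)"
    by (rule linorder_injI) (use less in fastforce)
  have "pos i \<in> {1..CARD('a)}" for i :: 'a
  proof -
    have "0 < card {..i}"
      by (rule card_gt_0_iff[THEN iffD2]) auto
    moreover have "card {..i} \<le> CARD('a)"
      by (rule card_mono) auto
    ultimately show ?thesis
      by (simp add: pos_def)
  qed
  then have "range (pos :: 'a \<Rightarrow> nat) \<subseteq> {1..CARD('a)}"
    by auto
  moreover have "card (range (pos :: 'a \<Rightarrow> nat)) = card {1..CARD('a)}"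
    using card_image[OF inj] by simp
  ultimately have "range (pos :: 'a \<Rightarrow> nat) = {1..CARD('a)}"
    by (intro card_subset_eq) auto
  with inj show ?thesis
    by (simp add: bij_betw_def)
qed

definition window :: "nat \<Rightarrow> nat \<Rightarrow> real ^ 'd::{finite,linorder}" where
  "window r k = (\<chi> i. if k \<le> pos i \<and> pos i \<le> k + r - 1 then 1 else 0)"

text \<open>Periodic extension, for \<open>k \<ge> 1\<close>, of the windows \<open>k = 1, \<dots>, d - r + 1\<close>.\<close>

definition phi :: "nat \<Rightarrow> nat \<Rightarrow> real ^ 'd::{finite,linorder}" where
  "phi r k = window r ((k - 1) mod (CARD('d) - r + 1) + 1)"

lemma phi_base:
  assumes "1 \<le> k" "k \<le> CARD('d) - r + 1"
  shows "(phi r k :: real ^ 'd::{finite,linorder}) = window r k"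
proof -
  have "(k - 1) mod (CARD('d) - r + 1) = k - 1"
    using assms by (intro mod_less) auto
  then show ?thesis
    using assms by (simp add: phi_def)
qed

lemma phi_periodic:
  assumes "1 \<le> k"
  shows "(phi r (k + (CARD('d) - r + 1)) :: real ^ 'd::{finite,linorder}) = phi r k"
proof -
  have "k + (CARD('d) - r + 1) - 1 = (k - 1) + (CARD('d) - r + 1)"
    using assms by simp
  then show ?thesis
    unfolding phi_def by (metis mod_add_self2)
qed

definition relu :: "real \<Rightarrow> real" where
  "relu z = max z 0"

text \<open>
  A parameter is a pair of the outer weights \<open>a\<close> and the inner weight vectors \<open>w\<close>; the library
  norm on this type is the Euclidean norm of all coordinates. The product \<open>*\<close> of two vectors
  in \<open>real ^ 'd\<close> is coordinatewise.
\<close>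

type_synonym ('m, 'd) params = "(real ^ 'm) \<times> ((real ^ 'd) ^ 'm)"

definition net ::
  "nat \<Rightarrow> ('m::{finite,linorder}, 'd::{finite,linorder}) params \<Rightarrow>
    real ^ 'd::{finite,linorder} \<Rightarrow> real" where
  "net r \<theta> x = (\<Sum>j\<in>UNIV. fst \<theta> $ j * relu (inner (snd \<theta> $ j) (x * phi r (pos j))))"

definition emp_loss ::
  "(real \<Rightarrow> real) \<Rightarrow> nat \<Rightarrow> nat \<Rightarrow> (nat \<Rightarrow> real ^ 'd::{finite,linorder}) \<Rightarrow> (nat \<Rightarrow> real) \<Rightarrow>
    real ^ 'm::{finite,linorder} \<Rightarrow> ('m::{finite,linorder}, 'd::{finite,linorder}) params \<Rightarrow> real" where
  "emp_loss l r n x y lam \<theta> =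
     (\<Sum>i=1..n. l (- y i * net r \<theta> (x i)))
     + 1/2 * (\<Sum>j\<in>UNIV. lam $ j * ((fst \<theta> $ j)\<^sup>2 + (norm (snd \<theta> $ j))\<^sup>2))"

text \<open>Since \<open>sgn 0 = 0\<close>, a sample with \<open>g (x i) = 0\<close> counts as an error.\<close>

definition training_error ::
  "nat \<Rightarrow> (nat \<Rightarrow> real ^ 'd::finite) \<Rightarrow> (nat \<Rightarrow> real) \<Rightarrow> (real ^ 'd::finite \<Rightarrow> real) \<Rightarrow> real" where
  "training_error n x y g = 1 / real n * (\<Sum>i=1..n. of_bool (y i \<noteq> sgn (g (x i))))"

definition local_minimum :: "('a::topological_space \<Rightarrow> real) \<Rightarrow> 'a \<Rightarrow> bool" where
  "local_minimum F p \<longleftrightarrow> (\<forall>\<^sub>F q in nhds p. F p \<le> F q)"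

definition coercive :: "('a::real_normed_vector \<Rightarrow> real) \<Rightarrow> bool" where
  "coercive F \<longleftrightarrow> filterlim F at_top at_infinity"

definition loss_assumption :: "(real \<Rightarrow> real) \<Rightarrow> bool" where
  "loss_assumption l \<longleftrightarrow>
     convex_on UNIV l \<and> mono l \<and>
     (\<forall>z. l differentiable at z) \<and> (\<forall>z. deriv l differentiable at z) \<and>
     1-lipschitz_on UNIV l \<and> 1-lipschitz_on UNIV (deriv l) \<and>
     (\<exists>a>0. \<forall>z. deriv l z \<le> exp (a * z)) \<and>
     deriv l 0 > 0"

definition hyp_class :: "nat \<Rightarrow> (real ^ 'd::{finite,linorder} \<Rightarrow> real) set" where
  "hyp_class r = (\<Union>M\<in>{1..}.
     {(\<lambda>x. \<Sum>j=1..M. c j * relu (inner (v j) (x * phi r j))) |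
        (c :: nat \<Rightarrow> real) (v :: nat \<Rightarrow> real ^ 'd::{finite,linorder}).
        (\<Sum>j=1..M. \<bar>c j\<bar>) = 1 \<and> (\<forall>j\<in>{1..M}. norm (v j) = 1)})"

definition dataset_assumption ::
  "nat \<Rightarrow> nat \<Rightarrow> (nat \<Rightarrow> real ^ 'd::{finite,linorder}) \<Rightarrow> (nat \<Rightarrow> real) \<Rightarrow> real \<Rightarrow> real \<Rightarrow> bool" where
  "dataset_assumption r n x y E \<gamma> \<longleftrightarrow>
     (\<forall>i\<in>{1..n}. norm (x i) \<le> 1) \<and>
     E \<in> {0..real n} \<and> \<gamma> \<in> {0<..1} \<and>
     (\<exists>h\<in>hyp_class r. (\<Sum>i=1..n. of_bool (y i * h (x i) \<ge> \<gamma>)) \<ge> real n - E)"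

end

theory Submission
  imports Defs
begin

text \<open>
  Let \<open>\<theta>\<close> be a local minimum and \<open>p i = y i * l' (- y i * f (x i))\<close>. Stationarity in both layers
  gives \<open>\<bar>a j\<bar> = \<parallel>w j\<parallel>\<close> for each neuron, and, if \<open>a j \<noteq> 0\<close>, that \<open>lam j\<close> is the distance from
  \<open>\<Sum>i\<in>A. p i x i\<close> to the span of \<open>{x i | i \<in> B}\<close>, where \<open>A\<close> and \<open>B\<close> are the samples
  (masked by the window of \<open>j\<close>) with positive and with zero preactivation. This is one of finitely
  many Lipschitz functions of \<open>p\<close>, which has only \<open>n\<close> coordinates, so \<open>n + 1\<close> active neurons
  confine \<open>lam\<close> to a null set. Otherwise every window has an inactive neuron; testing minimality
  by switching it on in direction \<open>u\<close> bounds the correlation of \<open>p\<close> with every unit ReLU by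
  \<open>lam0\<close>, hence also the correlation of \<open>p\<close> with the separating function \<open>h\<close>. Each misclassified
  sample on which \<open>h\<close> has margin \<open>\<gamma>\<close> contributes at least \<open>\<gamma> * l' 0\<close> to the latter.
\<close>

section \<open>Bounds on the scalar loss, and coercivity\<close>

text \<open>Everything follows from the tangent inequality of convexity: at \<open>z - 1\<close>
  with monotonicity, at \<open>z + 1\<close> with the Lipschitz bound, and for two points by adding
  their tangent inequalities.\<close>

lemma loss_derivative:
  assumes "loss_assumption l"
  shows "(l has_real_derivative deriv l z) (at z)"
    and "0 \<le> deriv l z" and "deriv l z \<le> 1"
    and "z \<le> z' \<Longrightarrow> deriv l z \<le> deriv l z'"
proof -
  have D: "(l has_real_derivative deriv l z) (at z)" for z
    using assms by (simp add: loss_assumption_def DERIV_deriv_iff_real_differentiable)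
  have tangent: "deriv l c * (t - c) \<le> l t - l c" for c t
    using assms D by (intro convex_on_imp_above_tangent[of UNIV]) (auto simp: loss_assumption_def)
  have "l (z - 1) \<le> l z"
    using assms by (simp add: loss_assumption_def monoD)
  then show "0 \<le> deriv l z"
    using tangent[of z "z - 1"] by simp
  have "dist (l (z + 1)) (l z) \<le> 1 * dist (z + 1) z"
    using assms by (intro lipschitz_onD[of 1 UNIV]) (auto simp: loss_assumption_def)
  then show "deriv l z \<le> 1"
    using tangent[of z "z + 1"] by (simp add: dist_real_def)
  show "deriv l z \<le> deriv l z'" if "z \<le> z'"
  proof (cases "z = z'")
    case False
    have "deriv l z * (z' - z) \<le> deriv l z' * (z' - z)"
      using tangent[of z z'] tangent[of z' z] by (simp add: algebra_simps)
    with False that show ?thesis by simp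
  qed simp
  show "(l has_real_derivative deriv l z) (at z)"
    by (rule D)
qed

text \<open>The bound \<open>exp (a * z)\<close> on the derivative is integrable at minus infinity:
  \<open>l z - exp (a * z) / a\<close> is nonincreasing, so left of 0 the loss falls at most
  \<open>1 / a\<close> below \<open>l 0\<close>.\<close>

lemma loss_bounded_below:
  assumes "loss_assumption l"
  obtains b where "\<And>z. b \<le> l z"
proof -
  obtain a where a: "a > 0" and exp: "\<And>z. deriv l z \<le> exp (a * z)"
    using assms by (auto simp: loss_assumption_def)
  have "l 0 - 1 / a \<le> l z" for z
  proof (cases "z \<le> 0")
    case True
    have "l 0 - exp (a * 0) / a \<le> l z - exp (a * z) / a"
    proof (rule DERIV_nonpos_imp_nonincreasing[OF True])
      fix t
      have "((\<lambda>z. l z - exp (a * z) / a) has_real_derivative deriv l t - exp (a * t)) (at t)"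
        using a by (auto intro!: derivative_eq_intros loss_derivative[OF assms])
      then show "\<exists>D. ((\<lambda>z. l z - exp (a * z) / a) has_real_derivative D) (at t) \<and> D \<le> 0"
        using exp[of t] by (intro exI[of _ "deriv l t - exp (a * t)"]) simp
    qed
    moreover have "0 \<le> exp (a * z) / a"
      using a by simp
    ultimately show ?thesis by simp
  next
    case False
    then have "l 0 \<le> l z"
      using assms by (simp add: loss_assumption_def monoD)
    moreover have "0 \<le> 1 / a"
      using a by simp
    ultimately show ?thesis by linarith
  qed
  then show thesis by (rule that)
qed

lemma norm_params_power2:
  fixes \<theta> :: "('m::{finite,linorder}, 'd::{finite,linorder}) params"
  shows "(norm \<theta>)\<^sup>2 = (\<Sum>j\<in>UNIV. (fst \<theta> $ j)\<^sup>2 + (norm (snd \<theta> $ j))\<^sup>2)"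
  by (simp add: norm_prod_def norm_vec_def L2_set_def sum_nonneg sum.distrib)

text \<open>The data term is bounded below, so the quadratic penalty, at least \<open>c / 2\<close>
  times the squared norm, forces growth.\<close>

lemma coercive_emp_loss:
  fixes lam :: "real ^ 'm::{finite,linorder}"
    and x :: "nat \<Rightarrow> real ^ 'd::{finite,linorder}"
  assumes loss: "loss_assumption l" and c: "c > 0" and lam: "\<And>j. c \<le> lam $ j"
  shows "coercive (emp_loss l r n x y lam)"
proof -
  obtain b where b: "\<And>z. b \<le> l z"
    using loss_bounded_below[OF loss] by blast
  have lower: "real n * b + c / 2 * (norm \<theta>)\<^sup>2 \<le> emp_loss l r n x y lam \<theta>" for \<theta>
  proof -
    have "(\<Sum>i=1..n. b) \<le> (\<Sum>i=1..n. l (- y i * net r \<theta> (x i)))"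
      by (intro sum_mono b)
    moreover have "c * (norm \<theta>)\<^sup>2 \<le> (\<Sum>j\<in>UNIV. lam $ j * ((fst \<theta> $ j)\<^sup>2 + (norm (snd \<theta> $ j))\<^sup>2))"
      unfolding norm_params_power2 sum_distrib_left by (intro sum_mono mult_right_mono lam) simp
    ultimately show ?thesis
      by (simp add: emp_loss_def)
  qed
  have "filterlim (\<lambda>\<theta> :: ('m, 'd) params. (norm \<theta>)\<^sup>2) at_top at_infinity"
    by (intro filterlim_pow_at_top filterlim_norm_at_top) simp
  then have "filterlim (\<lambda>\<theta> :: ('m, 'd) params. real n * b + c / 2 * (norm \<theta>)\<^sup>2) at_top at_infinity"
    using c by (intro filterlim_tendsto_add_at_top[OF tendsto_const]
        filterlim_tendsto_pos_mult_at_top[OF tendsto_const]) auto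
  then show ?thesis
    unfolding coercive_def by (rule filterlim_at_top_mono) (intro always_eventually allI lower)
qed

section \<open>First-order conditions at a local minimum\<close>

lemma relu_scale: "0 \<le> c \<Longrightarrow> relu (c * z) = c * relu z"
  by (simp add: relu_def max_mult_distrib_left)

lemma net_update:
  "net r (\<chi> k. if k = j then a else fst \<theta> $ k, \<chi> k. if k = j then w else snd \<theta> $ k) x =
    net r \<theta> x + (a * relu (w \<bullet> (x * phi r (pos j))) -
      fst \<theta> $ j * relu (snd \<theta> $ j \<bullet> (x * phi r (pos j))))"
proof -
  have "(\<Sum>k\<in>UNIV - {j}. (if k = j then a else fst \<theta> $ k) *
      relu ((if k = j then w else snd \<theta> $ k) \<bullet> (x * phi r (pos k)))) =
    (\<Sum>k\<in>UNIV - {j}. fst \<theta> $ k * relu (snd \<theta> $ k \<bullet> (x * phi r (pos k))))"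
    by (rule sum.cong) auto
  then show ?thesis
    by (simp add: net_def sum.remove[of UNIV j])
qed

text \<open>
  The network is only piecewise smooth, so the first-order condition is one-sided. Allowing an
  arbitrary curve lets an inactive neuron be moved at speed \<open>sqrt t\<close>, so that the
  second-order change of the product of its weights becomes a first-order one.
\<close>

lemma first_order_condition:
  fixes \<theta> :: "('m::{finite,linorder}, 'd::{finite,linorder}) params"
    and \<alpha> :: "real \<Rightarrow> real" and \<omega> :: "real \<Rightarrow> real ^ 'd::{finite,linorder}"
  assumes l: "\<And>z. (l has_real_derivative l' z) (at z)"
    and min: "local_minimum (emp_loss l r n x y lam) \<theta>"
    and \<alpha>: "(\<alpha> \<longlongrightarrow> fst \<theta> $ j) (at_right 0)" and \<omega>: "(\<omega> \<longlongrightarrow> snd \<theta> $ j) (at_right 0)"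
    and pre: "\<And>i. i \<in> {1..n} \<Longrightarrow> \<forall>\<^sub>F t in at_right 0.
      \<alpha> t * relu (\<omega> t \<bullet> (x i * phi r (pos j))) =
      fst \<theta> $ j * relu (snd \<theta> $ j \<bullet> (x i * phi r (pos j))) + t * q i"
    and reg: "\<forall>\<^sub>F t in at_right 0.
      (\<alpha> t)\<^sup>2 + (norm (\<omega> t))\<^sup>2 = (fst \<theta> $ j)\<^sup>2 + (norm (snd \<theta> $ j))\<^sup>2 + t * (2 * e) + t\<^sup>2 * e'"
  shows "(\<Sum>i=1..n. y i * l' (- y i * net r \<theta> (x i)) * q i) \<le> lam $ j * e"
proof (rule ccontr)
  let ?L = "emp_loss l r n x y lam"
  define c where "c t = (\<chi> k. if k = j then \<alpha> t else fst \<theta> $ k,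
    \<chi> k. if k = j then \<omega> t else snd \<theta> $ k)" for t
  define R where "R = (\<Sum>k\<in>UNIV. lam $ k * ((fst \<theta> $ k)\<^sup>2 + (norm (snd \<theta> $ k))\<^sup>2))"
  \<comment> \<open>\<open>g\<close> is what the loss becomes on the curve for small positive
    \<open>t\<close>: \<open>pre\<close> makes the outputs affine in \<open>t\<close>,
    \<open>reg\<close> makes the penalty quadratic. It has slope \<open>D\<close> at 0, although the
    loss itself need not be differentiable at \<open>\<theta>\<close>.\<close>
  define g where "g t = (\<Sum>i=1..n. l (- y i * (net r \<theta> (x i) + t * q i)))
    + 1/2 * (R + lam $ j * (t * (2 * e) + t\<^sup>2 * e'))" for t
  define D where "D = (\<Sum>i=1..n. l' (- y i * net r \<theta> (x i)) * (- y i * q i)) + lam $ j * e"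
  assume "\<not> ?thesis"
  then have "D < 0"
    by (simp add: D_def sum_negf algebra_simps)
  moreover have "(g has_real_derivative D) (at 0)"
    unfolding g_def D_def
    by (auto intro!: derivative_eq_intros DERIV_chain2[OF l] sum.cong simp: algebra_simps)
  ultimately have "\<exists>d>0. \<forall>h>0. h < d \<longrightarrow> g h < g 0"
    using DERIV_neg_dec_right[of g D 0] by simp
  then obtain \<delta> where \<delta>: "\<delta> > 0" "\<And>h. 0 < h \<Longrightarrow> h < \<delta> \<Longrightarrow> g h < g 0"
    by blast
  have dec: "\<forall>\<^sub>F t in at_right 0. g t < g 0"
    using \<delta> by (auto simp: eventually_at_right[of 0 1])
  have "(c \<longlongrightarrow> \<theta>) (at_right 0)"
  proof -
    have "((\<lambda>t. \<chi> k. if k = j then \<alpha> t else fst \<theta> $ k) \<longlongrightarrow> fst \<theta>) (at_right 0)"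
    proof (rule vec_tendstoI)
      show "((\<lambda>t. (\<chi> k. if k = j then \<alpha> t else fst \<theta> $ k) $ k) \<longlongrightarrow> fst \<theta> $ k) (at_right 0)" for k
        using \<alpha> by (cases "k = j") simp_all
    qed
    moreover have "((\<lambda>t. \<chi> k. if k = j then \<omega> t else snd \<theta> $ k) \<longlongrightarrow> snd \<theta>) (at_right 0)"
    proof (rule vec_tendstoI)
      show "((\<lambda>t. (\<chi> k. if k = j then \<omega> t else snd \<theta> $ k) $ k) \<longlongrightarrow> snd \<theta> $ k) (at_right 0)" for k
        using \<omega> by (cases "k = j") simp_all
    qed
    ultimately show ?thesis
      unfolding c_def using tendsto_Pair by fastforce
  qed
  then have inc: "\<forall>\<^sub>F t in at_right 0. ?L \<theta> \<le> ?L (c t)"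
    using min unfolding local_minimum_def by (rule eventually_compose_filterlim[rotated])
  have pre': "\<forall>\<^sub>F t in at_right 0. \<forall>i\<in>{1..n}.
      \<alpha> t * relu (\<omega> t \<bullet> (x i * phi r (pos j))) =
      fst \<theta> $ j * relu (snd \<theta> $ j \<bullet> (x i * phi r (pos j))) + t * q i"
    using pre by (intro eventually_ball_finite) auto
  have "\<forall>\<^sub>F t in at_right (0::real). False"
    using dec inc pre' reg
  proof eventually_elim
    case (elim t)
    have net: "net r (c t) (x i) = net r \<theta> (x i) + t * q i" if "i \<in> {1..n}" for i
      unfolding c_def net_update using elim(3) that by simp
    have "(\<Sum>k\<in>UNIV - {j}. lam $ k * ((fst (c t) $ k)\<^sup>2 + (norm (snd (c t) $ k))\<^sup>2)) =
      (\<Sum>k\<in>UNIV - {j}. lam $ k * ((fst \<theta> $ k)\<^sup>2 + (norm (snd \<theta> $ k))\<^sup>2))"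
      by (rule sum.cong) (auto simp: c_def)
    moreover have "fst (c t) $ j = \<alpha> t" "snd (c t) $ j = \<omega> t"
      by (simp_all add: c_def)
    ultimately have "(\<Sum>k\<in>UNIV. lam $ k * ((fst (c t) $ k)\<^sup>2 + (norm (snd (c t) $ k))\<^sup>2)) =
        R + lam $ j * (t * (2 * e) + t\<^sup>2 * e')"
      using elim(4) by (simp add: R_def sum.remove[of UNIV j]) (simp add: algebra_simps)
    then have "?L (c t) = g t"
      using net by (simp add: emp_loss_def g_def)
    moreover have "?L \<theta> = g 0"
      by (simp add: emp_loss_def g_def R_def)
    ultimately show False
      using elim by simp
  qed
  then show False
    by simp
qed

context
  fixes l l' :: "real \<Rightarrow> real" and r n :: nat and x :: "nat \<Rightarrow> real ^ 'd::{finite,linorder}"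
    and y :: "nat \<Rightarrow> real" and lam :: "real ^ 'm::{finite,linorder}"
    and \<theta> :: "('m, 'd) params"
  assumes l: "\<And>z. (l has_real_derivative l' z) (at z)"
    and min: "local_minimum (emp_loss l r n x y lam) \<theta>"
begin

text \<open>The network is linear in an outer weight, so the one-sided condition holds for the
  directions \<open>s = 1\<close> and \<open>s = -1\<close>, which gives equality.\<close>

lemma stationary_outer:
  "(\<Sum>i=1..n. y i * l' (- y i * net r \<theta> (x i)) * relu (snd \<theta> $ j \<bullet> (x i * phi r (pos j)))) =
    lam $ j * fst \<theta> $ j"
proof -
  have le: "(\<Sum>i=1..n. y i * l' (- y i * net r \<theta> (x i)) *
      (s * relu (snd \<theta> $ j \<bullet> (x i * phi r (pos j))))) \<le> lam $ j * (s * fst \<theta> $ j)" for s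
  proof (rule first_order_condition[OF l min, where \<alpha> = "\<lambda>t. fst \<theta> $ j + t * s"
      and \<omega> = "\<lambda>t. snd \<theta> $ j" and e' = "s\<^sup>2"])
    show "((\<lambda>t. fst \<theta> $ j + t * s) \<longlongrightarrow> fst \<theta> $ j) (at_right 0)"
      by (auto intro!: tendsto_eq_intros)
  qed (auto simp: algebra_simps power2_eq_square)
  show ?thesis
    using le[of 1] le[of "-1"] by (simp add: sum_negf)
qed

text \<open>
  Moving orthogonally to the inputs on which the neuron vanishes keeps all its activations linear.
\<close>

lemma stationary_inner:
  assumes v: "\<And>i. i \<in> {1..n} \<Longrightarrow> snd \<theta> $ j \<bullet> (x i * phi r (pos j)) = 0 \<Longrightarrow>
    v \<bullet> (x i * phi r (pos j)) = 0"
  shows "fst \<theta> $ j * (\<Sum>i | i \<in> {1..n} \<and> 0 < snd \<theta> $ j \<bullet> (x i * phi r (pos j)).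
    y i * l' (- y i * net r \<theta> (x i)) * (v \<bullet> (x i * phi r (pos j)))) = lam $ j * (snd \<theta> $ j \<bullet> v)"
    (is "_ * ?S v = _")
proof -
  let ?X = "\<lambda>i. x i * phi r (pos j)"
  have le: "fst \<theta> $ j * ?S v \<le> lam $ j * (snd \<theta> $ j \<bullet> v)"
    if v: "\<And>i. i \<in> {1..n} \<Longrightarrow> snd \<theta> $ j \<bullet> ?X i = 0 \<Longrightarrow> v \<bullet> ?X i = 0" for v
  proof -
    have "(\<Sum>i=1..n. y i * l' (- y i * net r \<theta> (x i)) *
      (fst \<theta> $ j * (if 0 < snd \<theta> $ j \<bullet> ?X i then v \<bullet> ?X i else 0))) \<le> lam $ j * (snd \<theta> $ j \<bullet> v)"
    proof (rule first_order_condition[OF l min, where \<alpha> = "\<lambda>t. fst \<theta> $ j"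
      and \<omega> = "\<lambda>t. snd \<theta> $ j + t *\<^sub>R v" and e' = "(norm v)\<^sup>2"])
      show "((\<lambda>t. snd \<theta> $ j + t *\<^sub>R v) \<longlongrightarrow> snd \<theta> $ j) (at_right 0)"
        by (auto intro!: tendsto_eq_intros)
      show "\<forall>\<^sub>F t in at_right 0. (fst \<theta> $ j)\<^sup>2 + (norm (snd \<theta> $ j + t *\<^sub>R v))\<^sup>2 =
          (fst \<theta> $ j)\<^sup>2 + (norm (snd \<theta> $ j))\<^sup>2 + t * (2 * (snd \<theta> $ j \<bullet> v)) + t\<^sup>2 * (norm v)\<^sup>2"
        unfolding power2_norm_eq_inner
        by (intro always_eventually allI) (simp add: inner_add_left inner_add_right inner_commute
            power2_eq_square algebra_simps)
      fix i assume i: "i \<in> {1..n}"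
      have lim: "((\<lambda>t. (snd \<theta> $ j + t *\<^sub>R v) \<bullet> ?X i) \<longlongrightarrow> snd \<theta> $ j \<bullet> ?X i) (at_right 0)"
        by (auto intro!: tendsto_eq_intros)
      \<comment> \<open>A strict sign of the preactivation persists for small \<open>t\<close>; a
        zero preactivation stays zero by the choice of \<open>v\<close>.\<close>
      consider "0 < snd \<theta> $ j \<bullet> ?X i" | "snd \<theta> $ j \<bullet> ?X i < 0" | "snd \<theta> $ j \<bullet> ?X i = 0"
        by linarith
      then show "\<forall>\<^sub>F t in at_right 0. fst \<theta> $ j * relu ((snd \<theta> $ j + t *\<^sub>R v) \<bullet> ?X i) =
         fst \<theta> $ j * relu (snd \<theta> $ j \<bullet> ?X i) +
         t * (fst \<theta> $ j * (if 0 < snd \<theta> $ j \<bullet> ?X i then v \<bullet> ?X i else 0))"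
      proof cases
        case 1
        from order_tendstoD(1)[OF lim 1] show ?thesis
          by eventually_elim (use 1 in \<open>simp add: relu_def algebra_simps\<close>)
      next
        case 2
        from order_tendstoD(2)[OF lim 2] show ?thesis
          by eventually_elim (use 2 in \<open>simp add: relu_def\<close>)
      next
        case 3
        then show ?thesis
          using v[OF i] by (simp add: inner_add_left)
      qed
    qed simp
    also have "(\<Sum>i=1..n. y i * l' (- y i * net r \<theta> (x i)) *
        (fst \<theta> $ j * (if 0 < snd \<theta> $ j \<bullet> ?X i then v \<bullet> ?X i else 0))) = fst \<theta> $ j * ?S v"
      unfolding sum_distrib_left
      by (rule sum.mono_neutral_cong_right) auto
    finally show ?thesis .
  qed
  show ?thesis
    using le[of v] le[of "- v"] v by (simp add: sum_negf)
qed

text \<open>Let \<open>z\<close> be the component of \<open>q\<close> orthogonal to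
  \<open>span B\<close>. Inner stationarity gives
  \<open>a *\<^sub>R z = lam $ j *\<^sub>R w\<close>, and the two layers together give
  \<open>norm w = \<bar>a\<bar>\<close>. Hence \<open>norm z\<close>, the distance from
  \<open>q\<close> to the span, is \<open>lam $ j\<close>.\<close>

lemma weight_decay_eq_infdist:
  assumes lam: "0 < lam $ j" and active: "fst \<theta> $ j \<noteq> 0"
  shows "lam $ j =
    infdist (\<Sum>i | i \<in> {1..n} \<and> 0 < snd \<theta> $ j \<bullet> (x i * phi r (pos j)).
        (y i * l' (- y i * net r \<theta> (x i))) *\<^sub>R (x i * phi r (pos j)))
      (span ((\<lambda>i. x i * phi r (pos j)) ` {i \<in> {1..n}. snd \<theta> $ j \<bullet> (x i * phi r (pos j)) = 0}))"
proof -
  define a where "a = fst \<theta> $ j"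
  define w where "w = snd \<theta> $ j"
  define X where "X i = x i * phi r (pos j)" for i
  define p where "p i = y i * l' (- y i * net r \<theta> (x i))" for i
  define A where "A = {i. i \<in> {1..n} \<and> 0 < w \<bullet> X i}"
  define B where "B = X ` {i \<in> {1..n}. w \<bullet> X i = 0}"
  define q where "q = (\<Sum>i\<in>A. p i *\<^sub>R X i)"
  have a: "a \<noteq> 0"
    using active by (simp add: a_def)
  have inner: "a * (q \<bullet> v) = lam $ j * (w \<bullet> v)" if "\<And>b. b \<in> B \<Longrightarrow> v \<bullet> b = 0" for v
  proof -
    have "q \<bullet> v = (\<Sum>i\<in>A. p i * (v \<bullet> X i))"
      by (simp add: q_def inner_sum_left inner_commute[of v])
    moreover have "a * (\<Sum>i\<in>A. p i * (v \<bullet> X i)) = lam $ j * (w \<bullet> v)"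
      using stationary_inner[of j v] that
      by (auto simp: a_def A_def p_def X_def w_def B_def)
    ultimately show ?thesis
      by simp
  qed
  have wB: "w \<bullet> b = 0" if "b \<in> B" for b
    using that by (auto simp: B_def)
  \<comment> \<open>This sum is the one in the outer condition. Comparing it with the inner
    condition at \<open>v = w\<close> balances the two layers.\<close>
  have "q \<bullet> w = (\<Sum>i=1..n. p i * relu (w \<bullet> X i))"
    unfolding q_def inner_sum_left A_def
    by (rule sum.mono_neutral_cong_left) (auto simp: relu_def inner_commute)
  also have "\<dots> = lam $ j * a"
    using stationary_outer[of j] by (simp add: p_def w_def X_def a_def)
  finally have "a * (lam $ j * a) = lam $ j * (w \<bullet> w)"
    using inner[of w] wB by simp
  then have balance: "norm w = \<bar>a\<bar>"
    using lam by (simp add: norm_eq_sqrt_inner flip: real_sqrt_abs power2_eq_square)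
  obtain s z where s: "s \<in> span B" and z: "\<And>b. b \<in> span B \<Longrightarrow> orthogonal z b" and q: "q = s + z"
    using orthogonal_subspace_decomp_exists[of B q] by metis
  \<comment> \<open>The defect \<open>e\<close> is itself orthogonal to \<open>B\<close>, hence an
    admissible test direction; testing with it gives \<open>e \<bullet> e = 0\<close>.\<close>
  define e where "e = a *\<^sub>R z - lam $ j *\<^sub>R w"
  have zB: "z \<bullet> b = 0" if "b \<in> B" for b
    using z span_base[OF that] by (auto simp: orthogonal_def)
  then have eB: "e \<bullet> b = 0" if "b \<in> B" for b
    using that wB by (simp add: e_def inner_diff_left)
  have "s \<bullet> e = 0"
    using orthogonal_to_span[OF s, of e] eB by (auto simp: orthogonal_def inner_commute)
  then have "a * (z \<bullet> e) = lam $ j * (w \<bullet> e)"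
    using inner[of e] eB by (simp add: q inner_add_left)
  moreover have "e \<bullet> e = a * (z \<bullet> e) - lam $ j * (w \<bullet> e)"
    by (subst (1) e_def) (simp add: inner_diff_left)
  ultimately have "e = 0"
    by simp
  then have "norm (a *\<^sub>R z) = norm (lam $ j *\<^sub>R w)"
    by (simp add: e_def)
  then have norm_z: "norm z = lam $ j"
    using a lam balance by simp
  have "infdist q (span B) = norm z"
  proof (rule antisym)
    show "infdist q (span B) \<le> norm z"
      using infdist_le[OF s, of q] by (simp add: q dist_norm)
    have "norm z \<le> dist q b" if b: "b \<in> span B" for b
    proof -
      have "orthogonal z (s - b)"
        using z span_diff[OF s b] by simp
      then have "(norm (z + (s - b)))\<^sup>2 = (norm z)\<^sup>2 + (norm (s - b))\<^sup>2"
        by (rule norm_add_Pythagorean)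
      then have "(norm z)\<^sup>2 \<le> (norm (z + (s - b)))\<^sup>2"
        by simp
      then have "norm z \<le> norm (z + (s - b))"
        by (rule power2_le_imp_le) simp
      also have "z + (s - b) = q - b"
        by (simp add: q)
      finally show ?thesis
        by (simp add: dist_norm)
    qed
    then show "norm z \<le> infdist q (span B)"
      using span_zero[of B] by (subst infdist_notempty) (auto intro!: cINF_greatest)
  qed
  then show ?thesis
    unfolding norm_z by (simp add: q_def A_def B_def p_def X_def w_def)
qed

text \<open>Inner stationarity at \<open>v = snd \<theta> $ j\<close> forces the inner weight to
  vanish too. Moving the weights to \<open>sqrt t * s\<close> and \<open>sqrt t *\<^sub>R u\<close>
  then adds \<open>t * s\<close> times the unit ReLU to the output and \<open>2 * t\<close> to the
  squared norm, so \<open>e = 1\<close>; both signs of \<open>s\<close> give the absolute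
  value.\<close>

lemma inactive_neuron_bound:
  assumes lam: "0 < lam $ j" and inactive: "fst \<theta> $ j = 0" and u: "norm u = 1"
  shows "\<bar>\<Sum>i=1..n. y i * l' (- y i * net r \<theta> (x i)) * relu (u \<bullet> (x i * phi r (pos j)))\<bar> \<le> lam $ j"
proof -
  have "lam $ j * (snd \<theta> $ j \<bullet> snd \<theta> $ j) = 0"
    using stationary_inner[of j "snd \<theta> $ j"] inactive by simp
  then have w: "snd \<theta> $ j = 0"
    using lam by simp
  have le: "(\<Sum>i=1..n. y i * l' (- y i * net r \<theta> (x i)) * (s * relu (u \<bullet> (x i * phi r (pos j)))))
      \<le> lam $ j * 1" if s: "s\<^sup>2 = 1" for s
  proof (rule first_order_condition[OF l min, where \<alpha> = "\<lambda>t. sqrt t * s"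
      and \<omega> = "\<lambda>t. sqrt t *\<^sub>R u" and e' = 0])
    have "((\<lambda>t. sqrt t * s) \<longlongrightarrow> sqrt 0 * s) (at_right 0)"
      by (intro tendsto_intros)
    then show "((\<lambda>t. sqrt t * s) \<longlongrightarrow> fst \<theta> $ j) (at_right 0)"
      using inactive by simp
    have "((\<lambda>t. sqrt t *\<^sub>R u) \<longlongrightarrow> sqrt 0 *\<^sub>R u) (at_right 0)"
      by (intro tendsto_intros)
    then show "((\<lambda>t. sqrt t *\<^sub>R u) \<longlongrightarrow> snd \<theta> $ j) (at_right 0)"
      using w by simp
    have pos: "\<forall>\<^sub>F t in at_right (0::real). 0 < t"
      by (simp add: eventually_at_right_less)
    show "\<forall>\<^sub>F t in at_right 0. (sqrt t * s)\<^sup>2 + (norm (sqrt t *\<^sub>R u))\<^sup>2 =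
        (fst \<theta> $ j)\<^sup>2 + (norm (snd \<theta> $ j))\<^sup>2 + t * (2 * 1) + t\<^sup>2 * 0"
      using pos by eventually_elim (use inactive w u s in \<open>simp add: power_mult_distrib\<close>)
    show "\<forall>\<^sub>F t in at_right 0. sqrt t * s * relu (sqrt t *\<^sub>R u \<bullet> (x i * phi r (pos j))) =
        fst \<theta> $ j * relu (snd \<theta> $ j \<bullet> (x i * phi r (pos j))) +
        t * (s * relu (u \<bullet> (x i * phi r (pos j))))" for i
      using pos by eventually_elim (use inactive in \<open>simp add: relu_scale\<close>)
  qed
  show ?thesis
    using le[of 1] le[of "-1"] by (auto simp: sum_negf abs_le_iff)
qed

end

section \<open>The null set of exceptional weight decays\<close>

text \<open>Only \<open>n\<close> reals determine \<open>n + 1\<close> coordinates. Storing them in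
  the coordinates \<open>J - {j0}\<close> exhibits the set inside the image of the hyperplane
  \<open>z $ j0 = 0\<close> under a Lipschitz self-map \<open>G\<close>, which is null.\<close>

lemma negligible_lipschitz_constraints:
  fixes F :: "'m::finite \<Rightarrow> (nat \<Rightarrow> real) \<Rightarrow> real"
  assumes card: "card J = n + 1"
    and lip: "\<And>j p p'. \<bar>F j p - F j p'\<bar> \<le> (\<Sum>i=1..n. \<bar>p i - p' i\<bar>)"
  shows "negligible {v :: real ^ 'm. \<exists>p. \<forall>j\<in>J. v $ j = F j p}"
proof -
  obtain j0 where j0: "j0 \<in> J"
    using card by fastforce
  have "card (J - {j0}) = card {1..n}"
    using card j0 by simp
  then obtain b where b: "bij_betw b {1..n} (J - {j0})"
    using finite_same_card_bij[of "{1..n}" "J - {j0}"] by auto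
  define G :: "real ^ 'm \<Rightarrow> real ^ 'm" where
    "G z = (\<chi> j. if j \<in> J then F j (\<lambda>i. z $ b i) else z $ j)" for z
  have lipG: "norm (G z' - G z) \<le> (real CARD('m) * (real n + 1)) * norm (z' - z)" for z z'
  proof -
    have "\<bar>(G z' - G z) $ j\<bar> \<le> (real n + 1) * norm (z' - z)" for j
    proof (cases "j \<in> J")
      case True
      then have "\<bar>(G z' - G z) $ j\<bar> \<le> (\<Sum>i=1..n. \<bar>z' $ b i - z $ b i\<bar>)"
        using lip[of j "\<lambda>i. z' $ b i" "\<lambda>i. z $ b i"] by (simp add: G_def)
      also have "\<dots> \<le> (\<Sum>i=1..n. norm (z' - z))"
        by (intro sum_mono) (metis component_le_norm_cart vector_minus_component)
      also have "\<dots> \<le> (real n + 1) * norm (z' - z)"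
        by (simp add: mult_right_mono)
      finally show ?thesis .
    next
      case False
      then have "\<bar>(G z' - G z) $ j\<bar> \<le> norm (z' - z)"
        using component_le_norm_cart[of "z' - z" j] by (simp add: G_def)
      also have "\<dots> \<le> (real n + 1) * norm (z' - z)"
        by (simp add: distrib_right)
      finally show ?thesis .
    qed
    then have "norm (G z' - G z) \<le> (\<Sum>j\<in>(UNIV::'m set). (real n + 1) * norm (z' - z))"
      by (intro order_trans[OF norm_le_l1_cart] sum_mono)
    then show ?thesis
      by (simp add: mult.assoc)
  qed
  have "negligible (G ` {z. z $ j0 = 0})"
    using lipG by (intro negligible_locally_Lipschitz_image negligible_standard_hyperplane_cart) auto
  moreover have "{v. \<exists>p. \<forall>j\<in>J. v $ j = F j p} \<subseteq> G ` {z. z $ j0 = 0}"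
  proof clarify
    fix v :: "real ^ 'm" and p assume v: "\<forall>j\<in>J. v $ j = F j p"
    define z :: "real ^ 'm" where
      \<comment> \<open>\<open>z\<close> stores \<open>p\<close> on \<open>{1..n}\<close> only. This
        suffices, because \<open>lip\<close> makes \<open>F j\<close> insensitive to all other
        arguments.\<close>
      "z = (\<chi> j. if j = j0 then 0 else if j \<in> J then p (the_inv_into {1..n} b j) else v $ j)"
    have F: "F j (\<lambda>i. z $ b i) = F j p" for j
    proof -
      have "z $ b i = p i" if "i \<in> {1..n}" for i
      proof -
        have "b i \<in> J - {j0}"
          using b that by (auto simp: bij_betw_def)
        moreover have "the_inv_into {1..n} b (b i) = i"
          using b that by (auto simp: bij_betw_def the_inv_into_f_f)
        ultimately show ?thesis
          by (simp add: z_def)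
      qed
      then show ?thesis
        using lip[of j "\<lambda>i. z $ b i" p] by simp
    qed
    have "v $ j = G z $ j" for j
    proof (cases "j \<in> J")
      case True
      then show ?thesis using v F by (simp add: G_def)
    next
      case False
      then show ?thesis using j0 by (auto simp: G_def z_def)
    qed
    then have "v = G z"
      by (simp add: vec_eq_iff)
    moreover have "z $ j0 = 0"
      by (simp add: z_def)
    ultimately show "v \<in> G ` {z. z $ j0 = 0}"
      by blast
  qed
  ultimately show ?thesis
    by (rule negligible_subset)
qed

lemma norm_mult_phi_le: "norm (x * phi r k) \<le> norm (x :: real ^ 'd::{finite,linorder})"
  by (rule norm_le_componentwise_cart) (simp add: phi_def window_def)

text \<open>The distance to a set is 1-Lipschitz, and the point is linear in \<open>p\<close> with
  coefficient vectors of norm at most 1.\<close>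

lemma infdist_sum_lipschitz:
  fixes X :: "nat \<Rightarrow> 'a::real_normed_vector"
  assumes "A \<subseteq> {1..n}" and X: "\<And>i. i \<in> {1..n} \<Longrightarrow> norm (X i) \<le> 1"
  shows "\<bar>infdist (\<Sum>i\<in>A. p i *\<^sub>R X i) S - infdist (\<Sum>i\<in>A. p' i *\<^sub>R X i) S\<bar> \<le>
    (\<Sum>i=1..n. \<bar>p i - p' i\<bar>)"
proof -
  have "\<bar>infdist (\<Sum>i\<in>A. p i *\<^sub>R X i) S - infdist (\<Sum>i\<in>A. p' i *\<^sub>R X i) S\<bar> \<le>
      norm (\<Sum>i\<in>A. (p i - p' i) *\<^sub>R X i)"
    using infdist_triangle_abs[of "\<Sum>i\<in>A. p i *\<^sub>R X i" S "\<Sum>i\<in>A. p' i *\<^sub>R X i"]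
    by (simp add: dist_norm scaleR_diff_left sum_subtractf)
  also have "\<dots> \<le> (\<Sum>i\<in>A. \<bar>p i - p' i\<bar>)"
  proof (rule sum_norm_le)
    fix i assume "i \<in> A"
    then have "norm (X i) \<le> 1"
      using assms(1) by (intro X) auto
    then show "norm ((p i - p' i) *\<^sub>R X i) \<le> \<bar>p i - p' i\<bar>"
      by (simp add: mult_left_le)
  qed
  also have "\<dots> \<le> (\<Sum>i=1..n. \<bar>p i - p' i\<bar>)"
    using assms(1) by (intro sum_mono2) auto
  finally show ?thesis .
qed

text \<open>For fixed \<open>J\<close>, \<open>A\<close>, \<open>B\<close> the constraints define a
  null set, and there are only finitely many such choices; \<open>p\<close> is the only continuous
  parameter.\<close>

lemma exceptional_weights:
  fixes X :: "'m::finite \<Rightarrow> nat \<Rightarrow> 'a::real_normed_vector"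
  assumes X: "\<And>j i. i \<in> {1..n} \<Longrightarrow> norm (X j i) \<le> 1"
  shows "negligible {v :: real ^ 'm. \<exists>J p A B. card J = n + 1 \<and>
    (\<forall>j. A j \<subseteq> {1..n} \<and> B j \<subseteq> {1..n}) \<and>
    (\<forall>j\<in>J. v $ j = infdist (\<Sum>i\<in>A j. p i *\<^sub>R X j i) (span (X j ` B j)))}" (is "negligible ?N")
proof -
  define N where "N J A B = {v :: real ^ 'm. \<exists>p. \<forall>j\<in>J.
    v $ j = infdist (\<Sum>i\<in>A j \<inter> {1..n}. p i *\<^sub>R X j i) (span (X j ` B j))}" for J A B
  let ?P = "Pi\<^sub>E (UNIV::'m set) (\<lambda>_. Pow {1..n})"
  have "finite (\<Union>J\<in>{J. card J = n + 1}. \<Union>A\<in>?P. (N J A) ` ?P)"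
    by (intro finite_UN_I finite_imageI finite_PiE) auto
  moreover have "negligible M" if "M \<in> (\<Union>J\<in>{J. card J = n + 1}. \<Union>A\<in>?P. (N J A) ` ?P)" for M
    using that unfolding N_def
    by (auto intro!: negligible_lipschitz_constraints infdist_sum_lipschitz X)
  ultimately have "negligible (\<Union>(\<Union>J\<in>{J. card J = n + 1}. \<Union>A\<in>?P. (N J A) ` ?P))"
    by (rule negligible_Union)
  moreover have "?N \<subseteq> \<Union>(\<Union>J\<in>{J. card J = n + 1}. \<Union>A\<in>?P. (N J A) ` ?P)"
  proof clarify
    fix v :: "real ^ 'm" and J p A B
    assume J: "card J = n + 1" and AB: "\<forall>j. A j \<subseteq> {1..n} \<and> B j \<subseteq> {1..n}"
      and v: "\<forall>j\<in>J. v $ j = infdist (\<Sum>i\<in>A j. p i *\<^sub>R X j i) (span (X j ` B j))"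
    have "A j \<inter> {1..n} = A j" for j
      using AB by auto
    then have "v \<in> N J A B"
      using v by (auto simp: N_def)
    moreover have "A \<in> ?P" "B \<in> ?P"
      using AB by auto
    ultimately show "v \<in> \<Union>(\<Union>J\<in>{J. card J = n + 1}. \<Union>A\<in>?P. (N J A) ` ?P)"
      using J by blast
  qed
  ultimately show ?thesis
    by (rule negligible_subset)
qed

section \<open>From inactive neurons to the training error\<close>

text \<open>Windows recur with period \<open>K\<close>, so among \<open>(n + 1) * K\<close> neurons
  each window is used by \<open>n + 1\<close> of them, too many for all to lie in
  \<open>T\<close>.\<close>

lemma window_outside:
  fixes T :: "'m::{finite,linorder} set"
  assumes T: "card T \<le> n" and m: "CARD('m) \<ge> (n + 1) * (CARD('d) - r + 1)"
  obtains j where "j \<notin> T"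
    and "(phi r (pos j) :: real ^ 'd::{finite,linorder}) = phi r k"
proof -
  define K where "K = CARD('d) - r + 1"
  \<comment> \<open>Positions start at 1, so the first occurrence of the window is at most
    \<open>K\<close> and the one for \<open>t = n\<close> at most
    \<open>K * (n + 1)\<close>.\<close>
  have "\<exists>j::'m. pos j = (k - 1) mod K + 1 + K * t" if "t \<le> n" for t
  proof -
    have "(k - 1) mod K < K"
      by (simp add: K_def)
    then have "(k - 1) mod K + 1 + K * t \<le> K * (n + 1)"
      using mult_le_mono2[OF that, of K] unfolding distrib_left mult_1_right by linarith
    also have "\<dots> \<le> CARD('m)"
      using m by (simp only: K_def mult.commute)
    finally have "(k - 1) mod K + 1 + K * t \<in> {1..CARD('m)}"
      by simp
    then have "(k - 1) mod K + 1 + K * t \<in> range (pos :: 'm \<Rightarrow> nat)"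
      using bij_betw_pos[where 'a='m] by (simp add: bij_betw_def)
    then show ?thesis
      by (metis rangeE)
  qed
  then obtain g :: "nat \<Rightarrow> 'm" where g: "\<And>t. t \<le> n \<Longrightarrow> pos (g t) = (k - 1) mod K + 1 + K * t"
    by metis
  have "inj_on g {..n}"
  proof (rule inj_onI)
    fix s t assume st: "s \<in> {..n}" "t \<in> {..n}" "g s = g t"
    then have "K * s = K * t"
      using g[of s] g[of t] by auto
    moreover have "0 < K"
      by (simp add: K_def)
    ultimately show "s = t"
      by simp
  qed
  then have "card (g ` {..n}) > card T"
    using T by (simp add: card_image)
  then have "\<not> g ` {..n} \<subseteq> T"
    by (meson card_mono finite linorder_not_less)
  then obtain t where t: "t \<le> n" "g t \<notin> T"
    by auto
  have "phi r (pos (g t)) = (phi r k :: real ^ 'd::{finite,linorder})"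
    unfolding phi_def K_def[symmetric] by (simp add: g[OF t(1)])
  with t show thesis
    by (intro that)
qed

lemma hyp_class_bounded:
  assumes "h \<in> hyp_class r" and z: "norm z \<le> 1"
  shows "\<bar>h z\<bar> \<le> 1"
proof -
  obtain M c v where h: "h = (\<lambda>x. \<Sum>j=1..M. c j * relu (v j \<bullet> (x * phi r j)))"
    and c: "(\<Sum>j=1..M. \<bar>c j\<bar>) = 1" and v: "\<forall>j\<in>{1..M::nat}. norm (v j) = 1"
    using assms(1) by (auto simp: hyp_class_def)
  have "\<bar>h z\<bar> \<le> (\<Sum>j=1..M. \<bar>c j * relu (v j \<bullet> (z * phi r j))\<bar>)"
    by (simp add: h sum_abs)
  also have "\<dots> \<le> (\<Sum>j=1..M. \<bar>c j\<bar>)"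
  proof (rule sum_mono)
    fix j assume "j \<in> {1..M}"
    then have "\<bar>v j \<bullet> (z * phi r j)\<bar> \<le> 1"
      using Cauchy_Schwarz_ineq2[of "v j" "z * phi r j"] norm_mult_phi_le[of z r j] v z by auto
    then have "\<bar>relu (v j \<bullet> (z * phi r j))\<bar> \<le> 1"
      by (auto simp: relu_def)
    then show "\<bar>c j * relu (v j \<bullet> (z * phi r j))\<bar> \<le> \<bar>c j\<bar>"
      by (simp add: abs_mult mult_left_le)
  qed
  finally show ?thesis
    using c by simp
qed

text \<open>Swapping the sums writes the correlation with \<open>h\<close> as a combination of
  single-unit correlations whose coefficients have absolute values summing to 1.\<close>

lemma hyp_class_correlation:
  assumes "h \<in> hyp_class r"
    and p: "\<And>k u. 1 \<le> k \<Longrightarrow> norm u = 1 \<Longrightarrow> \<bar>\<Sum>i=1..n. p i * relu (u \<bullet> (x i * phi r k))\<bar> \<le> L"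
  shows "(\<Sum>i=1..n. p i * h (x i)) \<le> L"
proof -
  obtain M c v where h: "h = (\<lambda>x. \<Sum>j=1..M. c j * relu (v j \<bullet> (x * phi r j)))"
    and c: "(\<Sum>j=1..M. \<bar>c j\<bar>) = 1" and v: "\<forall>j\<in>{1..M::nat}. norm (v j) = 1"
    using assms(1) by (auto simp: hyp_class_def)
  have "(\<Sum>i=1..n. p i * h (x i)) = (\<Sum>j=1..M. c j * (\<Sum>i=1..n. p i * relu (v j \<bullet> (x i * phi r j))))"
    unfolding h sum_distrib_left by (subst sum.swap) (simp add: algebra_simps)
  also have "\<dots> \<le> (\<Sum>j=1..M. \<bar>c j\<bar> * L)"
  proof (rule sum_mono)
    fix j assume "j \<in> {1..M}"
    then have "\<bar>\<Sum>i=1..n. p i * relu (v j \<bullet> (x i * phi r j))\<bar> \<le> L"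
      using v by (intro p) auto
    then have "\<bar>c j\<bar> * \<bar>\<Sum>i=1..n. p i * relu (v j \<bullet> (x i * phi r j))\<bar> \<le> \<bar>c j\<bar> * L"
      by (intro mult_left_mono) auto
    then show "c j * (\<Sum>i=1..n. p i * relu (v j \<bullet> (x i * phi r j))) \<le> \<bar>c j\<bar> * L"
      by (simp add: abs_mult[symmetric])
  qed
  also have "\<dots> = (\<Sum>j=1..M. \<bar>c j\<bar>) * L"
    by (simp add: sum_distrib_right)
  also have "\<dots> = L"
    unfolding c by simp
  finally show ?thesis .
qed

text \<open>Summing \<open>pointwise\<close> compares the number of errors with the correlation of
  \<open>h\<close>, which is at most \<open>L\<close>, plus 2 for each of the at most
  \<open>E\<close> samples without margin.\<close>

lemma training_error_bound:
  fixes x :: "nat \<Rightarrow> real ^ 'd::{finite,linorder}" and f :: "real ^ 'd::{finite,linorder} \<Rightarrow> real"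
  assumes y: "\<forall>i\<in>{1..n}. y i \<in> {-1, 1}" and loss: "loss_assumption l"
    and data: "dataset_assumption r n x y E \<gamma>"
    and p: "\<And>k u. 1 \<le> k \<Longrightarrow> norm u = 1 \<Longrightarrow>
      \<bar>\<Sum>i=1..n. y i * deriv l (- y i * f (x i)) * relu (u \<bullet> (x i * phi r k))\<bar> \<le> L"
  shows "training_error n x y f \<le> (L + 2 * E) / (deriv l 0 * \<gamma> * real n)"
proof -
  obtain h where h: "h \<in> hyp_class r"
    and good: "(\<Sum>i=1..n. of_bool (y i * h (x i) \<ge> \<gamma>)) \<ge> real n - E"
    using data by (auto simp: dataset_assumption_def)
  have \<gamma>: "0 < \<gamma>" "\<gamma> \<le> 1" and x: "\<And>i. i \<in> {1..n} \<Longrightarrow> norm (x i) \<le> 1"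
    using data by (auto simp: dataset_assumption_def)
  have l0: "0 < deriv l 0"
    using loss by (simp add: loss_assumption_def)
  define err :: "nat \<Rightarrow> real" where "err i = of_bool (y i \<noteq> sgn (f (x i)))" for i
  define q where "q i = deriv l (- y i * f (x i))" for i
  define ok :: "nat \<Rightarrow> real" where "ok i = of_bool (y i * h (x i) \<ge> \<gamma>)" for i
  have pointwise: "deriv l 0 * \<gamma> * err i \<le> y i * q i * h (x i) + 2 * (1 - ok i)"
    if i: "i \<in> {1..n}" for i
  proof -
    have q: "0 \<le> q i" "q i \<le> 1"
      using loss_derivative[OF loss] by (auto simp: q_def)
    have q_err: "deriv l 0 * err i \<le> q i"
    proof (cases "y i = sgn (f (x i))")
      case True
      then show ?thesis using q by (simp add: err_def)
    next
      case False
      \<comment> \<open>An error, including the case of output 0, puts the argument of the loss at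
        or above 0, where the slope is at least \<open>deriv l 0\<close>.\<close>
      then have "0 \<le> - y i * f (x i)"
        using bspec[OF y i] by (auto simp: sgn_if split: if_splits)
      then show ?thesis
        using loss_derivative(4)[OF loss, of 0 "- y i * f (x i)"] False
        by (simp add: err_def q_def)
    qed
    show ?thesis
    proof (cases "y i * h (x i) \<ge> \<gamma>")
      case True
      have "deriv l 0 * err i * \<gamma> \<le> q i * (y i * h (x i))"
        using q_err q \<gamma> True by (intro mult_mono) auto
      then show ?thesis
        using True by (simp add: ok_def algebra_simps)
    next
      case False
      \<comment> \<open>Without margin the left side is at most 1 and the correlation term at least
        -1, whence the constant 2.\<close>
      have "deriv l 0 * err i * \<gamma> \<le> 1 * 1"
        using q_err q \<gamma> by (intro mult_mono) auto
      moreover have "\<bar>y i * q i * h (x i)\<bar> \<le> 1 * 1 * 1"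
        unfolding abs_mult using q hyp_class_bounded[OF h x[OF i]] bspec[OF y i]
        by (intro mult_mono) auto
      ultimately show ?thesis
        using False by (simp add: ok_def algebra_simps)
    qed
  qed
  have "deriv l 0 * \<gamma> * (\<Sum>i=1..n. err i) \<le> (\<Sum>i=1..n. y i * q i * h (x i) + 2 * (1 - ok i))"
    unfolding sum_distrib_left using pointwise by (rule sum_mono)
  also have "\<dots> = (\<Sum>i=1..n. y i * q i * h (x i)) + 2 * (real n - (\<Sum>i=1..n. ok i))"
    by (simp add: sum.distrib sum_subtractf flip: sum_distrib_left)
  also have "\<dots> \<le> L + 2 * E"
    using hyp_class_correlation[OF h p] good by (simp add: q_def ok_def)
  finally have "(\<Sum>i=1..n. err i) \<le> (L + 2 * E) / (deriv l 0 * \<gamma>)"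
    using l0 \<gamma> by (simp add: pos_le_divide_eq mult.commute)
  then have "(\<Sum>i=1..n. err i) / real n \<le> (L + 2 * E) / (deriv l 0 * \<gamma>) / real n"
    by (rule divide_right_mono) simp
  then show ?thesis
    by (simp add: training_error_def err_def)
qed

theorem theorem1:
  fixes r n :: nat
    and x :: "nat \<Rightarrow> real ^ 'd::{finite,linorder}"
    and y :: "nat \<Rightarrow> real"
    and l :: "real \<Rightarrow> real"
    and lam0 E \<gamma> :: real
  assumes "n \<ge> 1"
    and "1 \<le> r" and "r \<le> CARD('d)"
    and "\<forall>i\<in>{1..n}. y i \<in> {-1, 1}"
    and "CARD('m::{finite,linorder}) \<ge> (n + 1) * (CARD('d) - r + 1)"
    and "0 < lam0" and "lam0 < real n"
    and "loss_assumption l"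
    and "dataset_assumption r n x y E \<gamma>"
  shows "\<exists>C :: (real ^ 'm::{finite,linorder}) set. C \<in> null_sets lebesgue \<and>
    (\<forall>lam :: real ^ 'm::{finite,linorder}. (\<forall>j. lam $ j \<in> {lam0 / 2 <..< lam0}) \<and> lam \<notin> C \<longrightarrow>
       coercive (emp_loss l r n x y lam) \<and>
       (\<forall>\<theta> :: ('m::{finite,linorder}, 'd) params. local_minimum (emp_loss l r n x y lam) \<theta> \<longrightarrow>
          training_error n x y (net r \<theta>) \<le> (lam0 + 2 * E) / (deriv l 0 * \<gamma> * real n)))"
proof -
  \<comment> \<open>\<open>C\<close> is fixed before \<open>lam\<close> and \<open>\<theta>\<close>:
    the derivative values and activation patterns of any local minimum are covered by the quantified
    \<open>p\<close>, \<open>A\<close> and \<open>B\<close>.\<close>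
  define C :: "(real ^ 'm::{finite,linorder}) set" where "C = {v. \<exists>J p A B. card J = n + 1 \<and>
    (\<forall>j. A j \<subseteq> {1..n} \<and> B j \<subseteq> {1..n}) \<and>
    (\<forall>j\<in>J. v $ j = infdist (\<Sum>i\<in>A j. p i *\<^sub>R (x i * phi r (pos j)))
      (span ((\<lambda>i. x i * phi r (pos j)) ` B j)))}"
  have x: "norm (x i) \<le> 1" if "i \<in> {1..n}" for i
    using assms(9) that by (auto simp: dataset_assumption_def)
  have "negligible C"
    unfolding C_def
    by (intro exceptional_weights) (use x norm_mult_phi_le order_trans in blast)
  then have "C \<in> null_sets lebesgue"
    by (simp add: negligible_iff_null_sets)
  moreover have "coercive (emp_loss l r n x y lam :: ('m, 'd) params \<Rightarrow> real)"
    if "\<forall>j. lam $ j \<in> {lam0 / 2 <..< lam0}" for lam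
    using assms(6) that by (intro coercive_emp_loss[OF assms(8), of "lam0 / 2"]) (auto intro: less_imp_le)
  moreover have "training_error n x y (net r \<theta>) \<le> (lam0 + 2 * E) / (deriv l 0 * \<gamma> * real n)"
    if lam: "\<forall>j. lam $ j \<in> {lam0 / 2 <..< lam0}" and "lam \<notin> C"
      and min: "local_minimum (emp_loss l r n x y lam) \<theta>"
    for lam and \<theta> :: "('m, 'd) params"
  proof -
    have lam_pos: "0 < lam $ j" and lam_le: "lam $ j \<le> lam0" for j
      using lam[rule_format, of j] assms(6) by auto
    define T where "T = {j. fst \<theta> $ j \<noteq> 0}"
    \<comment> \<open>More than \<open>n\<close> active neurons would express \<open>n + 1\<close>
      weight decays through the same \<open>p\<close>, which puts \<open>lam\<close> into
      \<open>C\<close>.\<close>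
    have card: "card T \<le> n"
    proof (rule ccontr)
      assume "\<not> card T \<le> n"
      then obtain J where J: "J \<subseteq> T" "card J = n + 1"
        using obtain_subset_with_card_n[of "n + 1" T] by auto
      have "lam \<in> C"
        unfolding C_def mem_Collect_eq
      proof (intro exI conjI ballI)
        show "lam $ j =
          infdist (\<Sum>i | i \<in> {1..n} \<and> 0 < snd \<theta> $ j \<bullet> (x i * phi r (pos j)).
              (y i * deriv l (- y i * net r \<theta> (x i))) *\<^sub>R (x i * phi r (pos j)))
            (span ((\<lambda>i. x i * phi r (pos j)) `
              {i \<in> {1..n}. snd \<theta> $ j \<bullet> (x i * phi r (pos j)) = 0}))" if "j \<in> J" for j
          using J that
          by (intro weight_decay_eq_infdist[OF loss_derivative(1)[OF assms(8)] min lam_pos])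
            (auto simp: T_def)
      qed (use J in auto)
      with \<open>lam \<notin> C\<close> show False ..
    qed
    show ?thesis
    proof (rule training_error_bound[OF assms(4,8,9)])
      fix k :: nat and u :: "real ^ 'd::{finite,linorder}" assume u: "norm u = 1"
      \<comment> \<open>With at most \<open>n\<close> active neurons, some neuron sharing the window
        of \<open>k\<close> is inactive and can test the direction \<open>u\<close>.\<close>
      obtain j :: 'm where j: "j \<notin> T" "(phi r (pos j) :: real ^ 'd::{finite,linorder}) = phi r k"
        using window_outside[OF card assms(5)] by blast
      have "\<bar>\<Sum>i=1..n. y i * deriv l (- y i * net r \<theta> (x i)) * relu (u \<bullet> (x i * phi r (pos j)))\<bar>
          \<le> lam $ j"
        using j(1) by (intro inactive_neuron_bound[OF loss_derivative(1)[OF assms(8)] min lam_pos _ u])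
          (simp add: T_def)
      then show "\<bar>\<Sum>i=1..n. y i * deriv l (- y i * net r \<theta> (x i)) * relu (u \<bullet> (x i * phi r k))\<bar>
          \<le> lam0"
        using lam_le[of j] by (simp add: j(2))
    qed
  qed
  ultimately show ?thesis
    by blast
qed

end
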